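(* Let $\mathcal{H}$ be a complex Hilbert space and let $f:\mathbb{D}\rightarrow\mathcal{B}(\mathcal{H})$ be analytic in $\mathbb{D}$ and continuous in $\overline{\mathbb{D}}$, such that $f(0)=\alpha I$ for some $\alpha\in\mathbb{C}$ with $|\alpha|<1$. Then $$M_{r}(f\circ\phi)\leq\|f\|_{\infty}\qquad\text{for } 0\leq r\leq 1/3,$$ where $\phi:\mathbb{D}\rightarrow\mathbb{D}$ is any analytic function with $\phi(0)=0$.
   Context: $\mathbb{D}=\{z\in\mathbb{C}:|z|<1\}$; $\mathcal{B}(\mathcal{H})$ is the algebra of bounded linear operators on $\mathcal{H}$ with operator norm $\|\cdot\|$, and $I$ is the identity operator. $\|f\|_{\infty}=\sup_{|z|<1}\|f(z)\|$. For a holomorphic function $u:\mathbb{D}\rightarrow\mathcal{B}(\mathcal{H})$ with $u(z)=\sum_{n=0}^{\infty}U_{n}z^{n}$, $U_n\in\mathcal{B}(\mathcal{H})$, the Bohr operator is $M_{r}(u)=\sum_{n=0}^{\infty}\|U_{n}\|r^{n}$ for $0\leq r<1$. *)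

theory Defs
  imports "HOL-Analysis.Analysis"
begin

section \<open>Complex Hilbert spaces\<close>

class scaleC =
  fixes scaleC :: "complex \<Rightarrow> 'a \<Rightarrow> 'a"  (infixr "*\<^sub>C" 75)

class complex_vector = real_vector + scaleC +
  assumes scaleC_add_right: "a *\<^sub>C (x + y) = a *\<^sub>C x + a *\<^sub>C y"
    and scaleC_add_left: "(a + b) *\<^sub>C x = a *\<^sub>C x + b *\<^sub>C x"
    and scaleC_scaleC: "a *\<^sub>C b *\<^sub>C x = (a * b) *\<^sub>C x"
    and scaleC_one: "1 *\<^sub>C x = x"
    and scaleR_scaleC: "t *\<^sub>R x = complex_of_real t *\<^sub>C x"

class complex_normed_vector = complex_vector + real_normed_vector +
  assumes norm_scaleC: "norm (a *\<^sub>C x) = cmod a * norm x"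

class complex_inner = complex_normed_vector +
  fixes cinner :: "'a \<Rightarrow> 'a \<Rightarrow> complex"
  assumes cinner_commute: "cinner x y = cnj (cinner y x)"
    and cinner_add_left: "cinner (x + y) z = cinner x z + cinner y z"
    and cinner_scaleC_left: "cinner (a *\<^sub>C x) y = a * cinner x y"
    and cinner_ge_zero: "0 \<le> Re (cinner x x)"
    and cinner_eq_zero_iff: "cinner x x = 0 \<longleftrightarrow> x = 0"
    and norm_eq_sqrt_cinner: "norm x = sqrt (Re (cinner x x))"

class chilbert_space = complex_inner + banach

instantiation complex :: chilbert_space
begin

definition scaleC_complex :: "complex \<Rightarrow> complex \<Rightarrow> complex"
  where "scaleC_complex a x = a * x"

definition cinner_complex :: "complex \<Rightarrow> complex \<Rightarrow> complex"
  where "cinner_complex x y = x * cnj y"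

instance
proof
  fix x :: complex
  show "norm x = sqrt (Re (cinner x x))"
    by (simp add: cinner_complex_def cmod_def power2_eq_square)
qed (simp_all add: scaleC_complex_def cinner_complex_def algebra_simps scaleR_conv_of_real norm_mult)

end

section \<open>Bounded complex-linear operators\<close>

definition bounded_clinear ::
    "('a::complex_normed_vector \<Rightarrow> 'b::complex_normed_vector) \<Rightarrow> bool"
  where "bounded_clinear T \<longleftrightarrow> bounded_linear T \<and> (\<forall>c x. T (c *\<^sub>C x) = c *\<^sub>C T x)"

typedef (overloaded) ('a, 'b) cblinfun =
  "{T :: 'a::complex_normed_vector \<Rightarrow> 'b::complex_normed_vector. bounded_clinear T}"
  morphisms cblinfun_apply CBlinfun
proof -
  have "(0::'b) = c *\<^sub>C 0" for c
    using scaleC_add_right[of c "0::'b" 0] by simp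
  then have "bounded_clinear (\<lambda>x::'a. 0::'b)"
    by (simp add: bounded_clinear_def)
  then show ?thesis by blast
qed

setup_lifting type_definition_cblinfun

lemma scaleC_zero_right: "c *\<^sub>C (0::'a::complex_vector) = 0"
  using scaleC_add_right[of c "0::'a" 0] by simp

lemma scaleC_minus_right: "c *\<^sub>C (- x) = - (c *\<^sub>C (x::'a::complex_vector))"
  using scaleC_add_right[of c "- x" x] by (simp add: scaleC_zero_right eq_neg_iff_add_eq_0)

lemma scaleC_diff_right: "c *\<^sub>C (x - y) = c *\<^sub>C x - c *\<^sub>C (y::'a::complex_vector)"
  using scaleC_add_right[of c x "- y"] by (simp add: scaleC_minus_right)

lemma bounded_linear_scaleC: "bounded_linear (\<lambda>x::'a::complex_normed_vector. c *\<^sub>C x)"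
  by (rule bounded_linear_intro[where K = "cmod c"])
    (simp_all add: scaleC_add_right norm_scaleC scaleR_scaleC scaleC_scaleC mult.commute)

instantiation cblinfun :: (complex_normed_vector, complex_normed_vector) complex_normed_vector
begin

lift_definition zero_cblinfun :: "('a, 'b) cblinfun" is "\<lambda>x. 0"
  by (simp add: bounded_clinear_def scaleC_zero_right)

lift_definition plus_cblinfun :: "('a, 'b) cblinfun \<Rightarrow> ('a, 'b) cblinfun \<Rightarrow> ('a, 'b) cblinfun"
  is "\<lambda>S T x. S x + T x"
  by (simp add: bounded_clinear_def scaleC_add_right bounded_linear_add)

lift_definition uminus_cblinfun :: "('a, 'b) cblinfun \<Rightarrow> ('a, 'b) cblinfun"
  is "\<lambda>T x. - T x"
  by (simp add: bounded_clinear_def scaleC_minus_right bounded_linear_minus)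

lift_definition minus_cblinfun :: "('a, 'b) cblinfun \<Rightarrow> ('a, 'b) cblinfun \<Rightarrow> ('a, 'b) cblinfun"
  is "\<lambda>S T x. S x - T x"
  by (simp add: bounded_clinear_def bounded_linear_sub scaleC_diff_right)

lift_definition scaleC_cblinfun :: "complex \<Rightarrow> ('a, 'b) cblinfun \<Rightarrow> ('a, 'b) cblinfun"
  is "\<lambda>c T x. c *\<^sub>C T x"
  by (simp add: bounded_clinear_def scaleC_scaleC mult.commute
      bounded_linear_compose[OF bounded_linear_scaleC])

definition scaleR_cblinfun :: "real \<Rightarrow> ('a, 'b) cblinfun \<Rightarrow> ('a, 'b) cblinfun"
  where "scaleR_cblinfun t T = complex_of_real t *\<^sub>C T"

lift_definition norm_cblinfun :: "('a, 'b) cblinfun \<Rightarrow> real" is onorm .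

definition dist_cblinfun :: "('a, 'b) cblinfun \<Rightarrow> ('a, 'b) cblinfun \<Rightarrow> real"
  where "dist_cblinfun S T = norm (S - T)"

definition sgn_cblinfun :: "('a, 'b) cblinfun \<Rightarrow> ('a, 'b) cblinfun"
  where "sgn_cblinfun T = inverse (norm T) *\<^sub>R T"

definition uniformity_cblinfun :: "(('a, 'b) cblinfun \<times> ('a, 'b) cblinfun) filter"
  where "uniformity_cblinfun = (INF e\<in>{0<..}. principal {(S, T). dist S T < e})"

definition open_cblinfun :: "('a, 'b) cblinfun set \<Rightarrow> bool"
  where "open_cblinfun U = (\<forall>T\<in>U. \<forall>\<^sub>F (S, S') in uniformity. S = T \<longrightarrow> S' \<in> U)"

lemma norm_scaleC_cblinfun: "norm (c *\<^sub>C T) = cmod c * norm (T :: ('a, 'b) cblinfun)"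
proof transfer
  fix c and T :: "'a \<Rightarrow> 'b"
  assume "bounded_clinear T"
  then have T: "bounded_linear T" by (simp add: bounded_clinear_def)
  have "onorm (\<lambda>x. c *\<^sub>C T x) = onorm (\<lambda>x. cmod c *\<^sub>R T x)"
    by (simp add: onorm_def norm_scaleC)
  then show "onorm (\<lambda>x. c *\<^sub>C T x) = cmod c * onorm T"
    by (simp add: onorm_scaleR[OF T])
qed

instance
proof
  fix S T R :: "('a, 'b) cblinfun" and a b :: complex and s t :: real
  show "S + T + R = S + (T + R)" by transfer (simp add: add.assoc)
  show "S + T = T + S" by transfer (simp add: add.commute)
  show "0 + S = S" by transfer simp
  show "- S + S = 0" by transfer simp
  show "S - T = S + - T" by transfer simp
  show addr: "a *\<^sub>C (S + T) = a *\<^sub>C S + a *\<^sub>C T" for a and S T :: "('a, 'b) cblinfun"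
    by transfer (simp add: scaleC_add_right)
  show addl: "(a + b) *\<^sub>C S = a *\<^sub>C S + b *\<^sub>C S" for a b and S :: "('a, 'b) cblinfun"
    by transfer (simp add: scaleC_add_left)
  show sc: "a *\<^sub>C b *\<^sub>C S = (a * b) *\<^sub>C S" for a b and S :: "('a, 'b) cblinfun"
    by transfer (simp add: scaleC_scaleC)
  show one: "1 *\<^sub>C S = S" for S :: "('a, 'b) cblinfun"
    by transfer (simp add: scaleC_one)
  show "t *\<^sub>R S = complex_of_real t *\<^sub>C S" by (simp add: scaleR_cblinfun_def)
  show "t *\<^sub>R (S + T) = t *\<^sub>R S + t *\<^sub>R T" by (simp add: scaleR_cblinfun_def addr)
  show "(s + t) *\<^sub>R S = s *\<^sub>R S + t *\<^sub>R S" by (simp add: scaleR_cblinfun_def addl)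
  show "s *\<^sub>R t *\<^sub>R S = (s * t) *\<^sub>R S" by (simp add: scaleR_cblinfun_def sc)
  show "1 *\<^sub>R S = S" by (simp add: scaleR_cblinfun_def one)
  show "norm (a *\<^sub>C S) = cmod a * norm S" by (rule norm_scaleC_cblinfun)
  show "norm (t *\<^sub>R S) = \<bar>t\<bar> * norm S" by (simp add: scaleR_cblinfun_def norm_scaleC_cblinfun)
  show "norm (S + T) \<le> norm S + norm T"
    by transfer (simp add: bounded_clinear_def onorm_triangle)
  show "norm S = 0 \<longleftrightarrow> S = 0"
    by transfer (auto simp add: bounded_clinear_def onorm_eq_0)
qed (simp_all add: dist_cblinfun_def sgn_cblinfun_def uniformity_cblinfun_def open_cblinfun_def)

end

lift_definition id_cblinfun :: "('a::complex_normed_vector, 'a) cblinfun" is "\<lambda>x. x"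
  by (simp add: bounded_clinear_def)

section \<open>Holomorphic vector-valued functions and the Bohr operator\<close>

text \<open>
  The library's \<^const>\<open>holomorphic_on\<close> requires values in a normed field. The following is its
  counterpart for values in a complex normed space: the derivative \<open>D\<close> is a limit of difference
  quotients in norm, that is, for operator-valued functions, in the operator norm.
\<close>

definition cholomorphic_on :: "(complex \<Rightarrow> 'a::complex_normed_vector) \<Rightarrow> complex set \<Rightarrow> bool"
    (infixl "cholomorphic'_on" 50)
  where "u cholomorphic_on S \<longleftrightarrow>
    (\<forall>z\<in>S. \<exists>D. (u has_derivative (\<lambda>h. h *\<^sub>C D)) (at z within S))"

text \<open>
  For \<open>u\<close> holomorphic on the unit disc (with values in a Banach space) there is exactly one
  sequence of coefficients as below.
\<close>

definition disc_coeffs :: "(complex \<Rightarrow> 'a::complex_normed_vector) \<Rightarrow> nat \<Rightarrow> 'a"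
  where "disc_coeffs u = (THE U. \<forall>z\<in>ball 0 1. (\<lambda>n. z ^ n *\<^sub>C U n) sums u z)"

text \<open>
  The power series of such a \<open>u\<close> converges in the whole disc, so the real series below converges
  for \<open>0 \<le> r < 1\<close>.
\<close>

definition bohr_operator :: "real \<Rightarrow> (complex \<Rightarrow> 'a::complex_normed_vector) \<Rightarrow> real"
  where "bohr_operator r u = (\<Sum>n. norm (disc_coeffs u n) * r ^ n)"

text \<open>A supremum of reals; only meaningful for \<open>u\<close> bounded on the disc.\<close>

definition disc_sup_norm :: "(complex \<Rightarrow> 'a::real_normed_vector) \<Rightarrow> real"
  where "disc_sup_norm u = (SUP z\<in>ball 0 1. norm (u z))"

end

theory Submission
  imports Defs "HOL-Complex_Analysis.Cauchy_Integral_Formula"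
begin

text \<open>
  Let \<open>u = f \<circ> \<phi>\<close> with coefficients \<open>U\<^sub>n\<close>, let \<open>M = \<parallel>f\<parallel>\<^sub>\<infinity>\<close>, and note \<open>u(0) = \<alpha> I\<close>. For \<open>n \<ge> 1\<close>, average
  \<open>\<langle>u(z) v(z), v(z)\<rangle>\<close> over the circle \<open>z = \<rho> w\<close>, \<open>\<bar>w\<bar> = 1\<close>, with the rotating vector
  \<open>v = x + \<kappa> w\<^sup>n y\<close>. The mean is \<open>\<alpha> (\<parallel>x\<parallel>\<^sup>2 + \<parallel>y\<parallel>\<^sup>2) + \<kappa>\<^sup>* \<rho>\<^sup>n \<langle>U\<^sub>n x, y\<rangle>\<close>, where \<open>\<kappa>\<^sup>*\<close> is the conjugate,
  whereas the modulus is at most \<open>M \<parallel>v\<parallel>\<^sup>2\<close>, whose mean is \<open>M (\<parallel>x\<parallel>\<^sup>2 + \<parallel>y\<parallel>\<^sup>2)\<close>. Choosing the unimodular \<open>\<kappa>\<close> so that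
  the two terms are aligned and letting \<open>\<rho> \<rightarrow> 1\<close> gives \<open>\<parallel>U\<^sub>n\<parallel> \<le> 2 (M - \<parallel>U\<^sub>0\<parallel>)\<close>. Hence
  \<open>M\<^sub>r(u) \<le> \<parallel>U\<^sub>0\<parallel> + (M - \<parallel>U\<^sub>0\<parallel>) 2 r / (1 - r) \<le> M\<close> for \<open>r \<le> 1/3\<close>.
\<close>

section \<open>Complex inner products and operators\<close>

lemma cinner_add_right: "cinner x (y + z) = cinner x y + cinner x (z::'a::complex_inner)"
  using cinner_add_left[of y z x] by (metis cinner_commute complex_cnj_add)

lemma cinner_scaleC_right: "cinner x (a *\<^sub>C y) = cnj a * cinner x (y::'a::complex_inner)"
  using cinner_scaleC_left[of a y x] by (metis cinner_commute complex_cnj_mult)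

lemma cinner_self: "cinner x x = complex_of_real ((norm (x::'a::complex_inner))\<^sup>2)"
proof -
  have "Im (cinner x x) = 0"
    using cinner_commute[of x x] by (metis Reals_cnj_iff complex_is_Real_iff)
  then show ?thesis
    using cinner_ge_zero[of x] by (simp add: complex_eq_iff norm_eq_sqrt_cinner)
qed

lemma scaleC_zero_left: "0 *\<^sub>C (x::'a::complex_vector) = 0"
  using scaleC_add_left[of 0 0 x] by simp

lemma norm_cinner_le: "cmod (cinner x y) \<le> norm x * norm (y::'a::complex_inner)"
proof (cases "y = 0")
  case True
  then have "cinner x y = 0"
    using cinner_scaleC_right[of x 0 y] by (simp add: scaleC_zero_left)
  then show ?thesis by simp
next
  case False
  define s where "s = complex_of_real ((norm y)\<^sup>2)"
  \<comment> \<open>Cauchy-Schwarz: \<open>v\<close> is the component of \<open>x\<close> orthogonal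
    to \<open>y\<close>, multiplied by the squared norm of \<open>y\<close> to avoid a division.
    Nonnegativity of \<open>cinner v v\<close> is the claim up to a positive factor.\<close>
  define v where "v = s *\<^sub>C x + (- cinner x y) *\<^sub>C y"
  have "cinner v v = s * (s * cinner x x - cinner x y * cinner y x)"
    by (simp add: v_def cinner_add_left cinner_add_right cinner_scaleC_left cinner_scaleC_right
        cinner_self[of y] flip: s_def cinner_commute[of y x])
      (simp add: s_def algebra_simps)
  also have "\<dots> = complex_of_real ((norm y)\<^sup>2 * ((norm y)\<^sup>2 * (norm x)\<^sup>2 - (cmod (cinner x y))\<^sup>2))"
    by (subst cinner_commute[of y x])
      (simp add: s_def cinner_self[of x] complex_norm_square[symmetric] del: of_real_power flip: of_real_power)
  finally have "0 \<le> (norm y)\<^sup>2 * ((norm y)\<^sup>2 * (norm x)\<^sup>2 - (cmod (cinner x y))\<^sup>2)"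
    using cinner_ge_zero[of v] by (metis Re_complex_of_real)
  then have "(cmod (cinner x y))\<^sup>2 \<le> (norm x * norm y)\<^sup>2"
    using False by (simp add: zero_le_mult_iff power_mult_distrib mult.commute)
  then show ?thesis
    by (rule power2_le_imp_le) simp
qed

lemma bounded_linear_cinner_left: "bounded_linear (\<lambda>x. cinner x (y::'a::complex_inner))"
  by (rule bounded_linear_intro[where K = "norm y"])
    (simp_all add: cinner_add_left scaleR_scaleC[of _ "_::'a"] cinner_scaleC_left norm_cinner_le scaleR_conv_of_real)

lemma cinner_eqI:
  fixes v w :: "'a::complex_inner"
  assumes "\<And>y. cinner v y = cinner w y"
  shows "v = w"
proof -
  interpret bounded_linear "\<lambda>x. cinner x (v - w)" by (rule bounded_linear_cinner_left)
  have "cinner (v - w) (v - w) = 0" by (simp add: diff assms)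
  then show ?thesis by (simp add: cinner_eq_zero_iff)
qed

text \<open>The test vector is \<open>v\<close> itself, rescaled to length \<open>s\<close>. Leaving
  \<open>s\<close> free allows tests on one sphere only, which later may have the radius of another
  given vector.\<close>

lemma norm_le_cinnerI:
  fixes v :: "'a::complex_inner"
  assumes "0 \<le> K" and "0 < s" and K: "\<And>y. norm y = s \<Longrightarrow> cmod (cinner v y) \<le> K * s"
  shows "norm v \<le> K"
proof (cases "v = 0")
  case False
  have "cinner v ((s / norm v) *\<^sub>R v) = complex_of_real (s * norm v)"
    using False by (simp add: scaleR_scaleC cinner_scaleC_right cinner_self power2_eq_square)
  moreover have "cmod (cinner v ((s / norm v) *\<^sub>R v)) \<le> K * s"
    using False \<open>0 < s\<close> by (intro K) simp
  ultimately have "s * norm v \<le> s * K"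
    using \<open>0 < s\<close> by (simp add: norm_mult mult.commute)
  then show ?thesis using \<open>0 < s\<close> by simp
qed (use \<open>0 \<le> K\<close> in simp)

lemma cblinfun_apply_add: "cblinfun_apply T (x + y) = cblinfun_apply T x + cblinfun_apply T y"
  and cblinfun_apply_scaleC: "cblinfun_apply T (c *\<^sub>C x) = c *\<^sub>C cblinfun_apply T x"
  using cblinfun_apply[of T] by (simp_all add: bounded_clinear_def linear_simps)

lemma norm_cblinfun_apply_le: "norm (cblinfun_apply T x) \<le> norm T * norm x"
  using cblinfun_apply[of T] by (simp add: norm_cblinfun.rep_eq bounded_clinear_def onorm)

lemma norm_cblinfun_leI:
  assumes "0 \<le> K" and "\<And>x. norm (cblinfun_apply T x) \<le> K * norm x"
  shows "norm T \<le> K"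
  using onorm_bound[OF assms] by (simp add: norm_cblinfun.rep_eq)

lemma bounded_linear_cblinfun_apply_left: "bounded_linear (\<lambda>T. cblinfun_apply T x)"
  by (rule bounded_linear_intro[where K = "norm x"])
    (simp_all add: plus_cblinfun.rep_eq scaleR_scaleC scaleC_cblinfun.rep_eq norm_cblinfun_apply_le)

lemma bounded_linear_cinner_cblinfun:
  "bounded_linear (\<lambda>T::('a::complex_normed_vector, 'h::complex_inner) cblinfun.
    cinner (cblinfun_apply T x) y)"
  by (rule bounded_linear_compose[OF bounded_linear_cinner_left bounded_linear_cblinfun_apply_left])

lemma cinner_cblinfun_scaleC:
  "cinner (cblinfun_apply (c *\<^sub>C T) x) y = c * cinner (cblinfun_apply T x) y"
  by (simp add: scaleC_cblinfun.rep_eq cinner_scaleC_left)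

lemma cmod_cinner_cblinfun_le: "cmod (cinner (cblinfun_apply T x) y) \<le> norm T * norm x * norm y"
  by (meson norm_cinner_le norm_cblinfun_apply_le mult_right_mono norm_ge_zero order_trans)

section \<open>Holomorphic operator-valued functions and their scalar functions\<close>

lemma cholomorphic_on_imp_continuous_on: "u cholomorphic_on S \<Longrightarrow> continuous_on S u"
  unfolding cholomorphic_on_def continuous_on_eq_continuous_within
  by (meson has_derivative_continuous)

lemma cholomorphic_on_const: "(\<lambda>z. c) cholomorphic_on S"
  unfolding cholomorphic_on_def by (auto intro!: exI[of _ 0] simp: scaleC_zero_right)

lemma cholomorphic_on_compose:
  assumes "\<phi> holomorphic_on S" and "u cholomorphic_on T" and "\<phi> ` S \<subseteq> T"
  shows "(u \<circ> \<phi>) cholomorphic_on S"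
  unfolding cholomorphic_on_def
proof
  fix z assume "z \<in> S"
  obtain d where d: "(\<phi> has_field_derivative d) (at z within S)"
    using assms(1) \<open>z \<in> S\<close> by (auto simp: holomorphic_on_def field_differentiable_def)
  obtain D where "(u has_derivative (\<lambda>h. h *\<^sub>C D)) (at (\<phi> z) within T)"
    using assms(2,3) \<open>z \<in> S\<close> by (auto simp: cholomorphic_on_def)
  then have "(u has_derivative (\<lambda>h. h *\<^sub>C D)) (at (\<phi> z) within \<phi> ` S)"
    using assms(3) by (rule has_derivative_subset)
  from diff_chain_within[OF d[unfolded has_field_derivative_def] this]
  have "(u \<circ> \<phi> has_derivative (\<lambda>h. h *\<^sub>C d *\<^sub>C D)) (at z within S)"
    by (simp add: o_def scaleC_scaleC mult.commute)
  then show "\<exists>D. (u \<circ> \<phi> has_derivative (\<lambda>h. h *\<^sub>C D)) (at z within S)" by blast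
qed

text \<open>Pairing with fixed \<open>x\<close> and \<open>y\<close> is bounded and complex-linear
  in the operator, so it preserves differentiability. Through this lemma the scalar Cauchy theory
  becomes available.\<close>

lemma holomorphic_on_cinner_cblinfun:
  fixes u :: "complex \<Rightarrow> ('a::complex_normed_vector, 'h::complex_inner) cblinfun"
  assumes "u cholomorphic_on S"
  shows "(\<lambda>z. cinner (cblinfun_apply (u z) x) y) holomorphic_on S"
  unfolding holomorphic_on_def field_differentiable_def
proof
  fix z assume "z \<in> S"
  then obtain D where "(u has_derivative (\<lambda>h. h *\<^sub>C D)) (at z within S)"
    using assms by (auto simp: cholomorphic_on_def)
  from bounded_linear.has_derivative[OF bounded_linear_cinner_cblinfun this]
  show "\<exists>d. ((\<lambda>z. cinner (cblinfun_apply (u z) x) y) has_field_derivative d) (at z within S)"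
    by (auto simp: has_field_derivative_def cinner_cblinfun_scaleC mult_commute_abs
        intro!: exI[of _ "cinner (cblinfun_apply D x) y"])
qed

section \<open>Power series of operator-valued holomorphic functions\<close>

text \<open>Cauchy's formula for derivatives, written as a mean over the circle: dz = 2 pi i z dt
  cancels the constant 2 pi i and one of the \<open>Suc n\<close> powers of z.\<close>

lemma has_integral_Cauchy_coefficient:
  assumes "F holomorphic_on ball 0 R" and "0 < \<rho>" and "\<rho> < R"
  shows "((\<lambda>t. F (circlepath 0 \<rho> t) / circlepath 0 \<rho> t ^ n) has_integral
    (deriv ^^ n) F 0 / fact n) {0..1}"
proof -
  have "cball 0 \<rho> \<subseteq> ball (0::complex) R" using assms by auto
  then have "continuous_on (cball 0 \<rho>) F" and "F holomorphic_on ball 0 \<rho>"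
    using assms(1) by (meson holomorphic_on_subset holomorphic_on_imp_continuous_on ball_subset_cball
        order_trans)+
  then have "((\<lambda>u. F u / (u - 0) ^ Suc n) has_contour_integral
      2 * pi * \<i> / fact n * (deriv ^^ n) F 0) (circlepath 0 \<rho>)"
    using \<open>0 < \<rho>\<close> by (intro Cauchy_has_contour_integral_higher_derivative_circlepath) auto
  then have "((\<lambda>t. F (circlepath 0 \<rho> t) / circlepath 0 \<rho> t ^ Suc n
      * vector_derivative (circlepath 0 \<rho>) (at t))
      has_integral 2 * pi * \<i> / fact n * (deriv ^^ n) F 0) {0..1}"
    by (simp add: has_contour_integral)
  from has_integral_divide[OF this, of "2 * pi * \<i>"] show ?thesis
  proof (rule has_integral_eq_rhs[OF has_integral_eq, rotated])
    fix t :: real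
    have "vector_derivative (circlepath 0 \<rho>) (at t) = 2 * pi * \<i> * circlepath 0 \<rho> t"
      unfolding vector_derivative_circlepath by (simp add: circlepath)
    moreover have "circlepath 0 \<rho> t \<noteq> 0"
      using \<open>0 < \<rho>\<close> by (simp add: circlepath)
    ultimately show "F (circlepath 0 \<rho> t) / circlepath 0 \<rho> t ^ Suc n
        * vector_derivative (circlepath 0 \<rho>) (at t) / (2 * pi * \<i>)
      = F (circlepath 0 \<rho> t) / circlepath 0 \<rho> t ^ n"
      by (simp add: field_simps)
  qed simp
qed

lemma higher_deriv_power_series:
  assumes "\<And>z. z \<in> ball 0 R \<Longrightarrow> (\<lambda>n. a n * z ^ n) sums F z" and "0 < R"
  shows "(deriv ^^ n) F 0 / fact n = (a n :: complex)"
proof -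
  have "F has_fps_expansion Abs_fps a"
  proof (rule has_fps_expansionI)
    have "eventually (\<lambda>z. z \<in> ball 0 R) (nhds (0::complex))"
      using \<open>0 < R\<close> by (intro eventually_nhds_in_open) auto
    then show "eventually (\<lambda>z. (\<lambda>n. fps_nth (Abs_fps a) n * z ^ n) sums F z) (nhds 0)"
      by eventually_elim (use assms(1) in simp)
  qed
  from fps_nth_fps_expansion[OF this, of n] show ?thesis by simp
qed

text \<open>Pairs of equal length suffice, because \<open>y\<close> may be tested on the sphere of
  radius \<open>norm x\<close>. This fits the quadratic mean, where \<open>x\<close> and
  \<open>y\<close> enter symmetrically through the sum of their squared norms.\<close>

lemma norm_cblinfun_le_cinnerI:
  fixes T :: "('a::complex_normed_vector, 'h::complex_inner) cblinfun"
  assumes "0 \<le> K"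
    and K: "\<And>x y. norm x = norm y \<Longrightarrow> cmod (cinner (cblinfun_apply T x) y) \<le> K * norm x * norm y"
  shows "norm T \<le> K"
proof (rule norm_cblinfun_leI[OF \<open>0 \<le> K\<close>])
  fix x :: 'a
  show "norm (cblinfun_apply T x) \<le> K * norm x"
  proof (cases "x = 0")
    case True
    then show ?thesis using norm_cblinfun_apply_le[of T x] by simp
  next
    case False
    show ?thesis
    proof (rule norm_le_cinnerI[of _ "norm x"])
      show "cmod (cinner (cblinfun_apply T x) y) \<le> K * norm x * norm x" if "norm y = norm x" for y
        using K[of x y] that by simp
    qed (use False \<open>0 \<le> K\<close> in simp_all)
  qed
qed

lemma bounded_bilinear_scaleC:
  "bounded_bilinear (scaleC :: complex \<Rightarrow> 'a::complex_normed_vector \<Rightarrow> 'a)"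
proof
  fix a b r and x y :: 'a
  show "(a + b) *\<^sub>C x = a *\<^sub>C x + b *\<^sub>C x" by (rule scaleC_add_left)
  show "a *\<^sub>C (x + y) = a *\<^sub>C x + a *\<^sub>C y" by (rule scaleC_add_right)
  show "(r *\<^sub>R a) *\<^sub>C x = r *\<^sub>R (a *\<^sub>C x)"
    by (simp add: scaleR_scaleC[of _ "_::'a"] scaleC_scaleC scaleR_conv_of_real)
  show "a *\<^sub>C (r *\<^sub>R x) = r *\<^sub>R (a *\<^sub>C x)"
    by (simp add: scaleR_scaleC[of _ "_::'a"] scaleC_scaleC mult.commute)
  show "\<exists>K. \<forall>a (x::'a). norm (a *\<^sub>C x) \<le> norm a * norm x * K"
    by (auto simp: norm_scaleC intro!: exI[of _ 1])
qed

text \<open>A bound for \<open>u\<close> on the compact disc of radius \<open>\<rho>\<close>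
  controls all the scalar functions at once. Having one \<open>B\<close> for all \<open>x\<close>,
  \<open>y\<close> and \<open>n\<close> is what turns weak estimates into operator-norm
  estimates.\<close>

lemma Cauchy_inequality_cinner:
  fixes u :: "complex \<Rightarrow> ('a::complex_normed_vector, 'h::complex_inner) cblinfun"
  assumes "u cholomorphic_on ball 0 1" and "0 < \<rho>" and "\<rho> < 1"
  obtains B where "0 \<le> B" and "\<And>n x y. cmod ((deriv ^^ n) (\<lambda>z. cinner (cblinfun_apply (u z) x) y) 0 / fact n)
    \<le> B / \<rho> ^ n * norm x * norm y"
proof -
  have sub: "cball 0 \<rho> \<subseteq> ball (0::complex) 1" using assms by auto
  then have "continuous_on (cball 0 \<rho>) u"
    using cholomorphic_on_imp_continuous_on[OF assms(1)] continuous_on_subset by blast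
  then have "bounded (u ` cball 0 \<rho>)"
    by (intro compact_imp_bounded compact_continuous_image) auto
  then obtain B where B: "\<And>z. z \<in> cball 0 \<rho> \<Longrightarrow> norm (u z) \<le> B"
    unfolding bounded_iff by blast
  have "0 \<le> B" using B[of 0] \<open>0 < \<rho>\<close> by (simp add: order_trans[OF norm_ge_zero])
  moreover
  have "cmod ((deriv ^^ n) (\<lambda>z. cinner (cblinfun_apply (u z) x) y) 0 / fact n)
      \<le> B / \<rho> ^ n * norm x * norm y" for n x y
  proof -
    let ?F = "\<lambda>z. cinner (cblinfun_apply (u z) x) y"
    have hol: "?F holomorphic_on ball 0 1" by (rule holomorphic_on_cinner_cblinfun[OF assms(1)])
    have "cmod ((deriv ^^ n) ?F 0) \<le> fact n * (B * norm x * norm y) / \<rho> ^ n"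
    proof (rule Cauchy_inequality)
      show "?F holomorphic_on ball 0 \<rho>"
        using hol sub by (meson holomorphic_on_subset ball_subset_cball order_trans)
      show "continuous_on (cball 0 \<rho>) ?F"
        using hol sub by (meson holomorphic_on_subset holomorphic_on_imp_continuous_on)
      fix z :: complex assume "norm (0 - z) = \<rho>"
      then have "norm (u z) \<le> B" by (intro B) simp
      then show "norm (?F z) \<le> B * norm x * norm y"
        by (meson cmod_cinner_cblinfun_le mult_right_mono norm_ge_zero order_trans)
    qed fact
    then show ?thesis by (simp add: norm_divide field_simps)
  qed
  ultimately show ?thesis by (rule that)
qed

text \<open>The operator sends \<open>x\<close> to the Cauchy integral of u(z) x over the circle of
  radius 1/2, an integral of vectors in a complete space. Uniqueness of integrals makes it linear;
  Cauchy's inequality makes it bounded.\<close>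

lemma cblinfun_of_Cauchy_coefficients:
  fixes u :: "complex \<Rightarrow> ('a::complex_normed_vector, 'h::chilbert_space) cblinfun"
  assumes "u cholomorphic_on ball 0 1"
  shows "\<exists>T. \<forall>x y. cinner (cblinfun_apply T x) y
    = (deriv ^^ n) (\<lambda>z. cinner (cblinfun_apply (u z) x) y) 0 / fact n"
proof -
  define a where "a = (\<lambda>x y. (deriv ^^ n) (\<lambda>z. cinner (cblinfun_apply (u z) x) y) 0 / fact n)"
  define e where "e = circlepath 0 (1 / 2)"
  define g where "g = (\<lambda>x t. inverse (e t ^ n) *\<^sub>C cblinfun_apply (u (e t)) x)"
  define G where "G = (\<lambda>x. integral {0..1} (g x))"
  have e0: "e t \<noteq> 0" for t by (simp add: e_def circlepath)
  have cont_e: "continuous_on {0..1} e"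
    unfolding e_def circlepath by (intro continuous_intros)
  have "continuous_on {0..1} (\<lambda>t. u (e t))"
    by (rule continuous_on_compose2[OF cholomorphic_on_imp_continuous_on[OF assms] cont_e])
      (auto simp: e_def circlepath norm_mult)
  then have "continuous_on {0..1} (g x)" for x
    unfolding g_def using e0 cont_e
    by (intro bounded_bilinear.continuous_on[OF bounded_bilinear_scaleC] continuous_intros
        bounded_linear.continuous_on[OF bounded_linear_cblinfun_apply_left]) auto
  then have G: "(g x has_integral G x) {0..1}" for x
    unfolding G_def by (intro integrable_integral integrable_continuous_real)
  have Ga: "cinner (G x) y = a x y" for x y
  proof -
    have "((\<lambda>t. cinner (cblinfun_apply (u (e t)) x) y / e t ^ n) has_integral a x y) {0..1}"
      unfolding a_def e_def
      by (rule has_integral_Cauchy_coefficient[OF holomorphic_on_cinner_cblinfun[OF assms]]) auto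
    moreover have "((\<lambda>t. cinner (cblinfun_apply (u (e t)) x) y / e t ^ n) has_integral cinner (G x) y) {0..1}"
      using has_integral_linear[OF G bounded_linear_cinner_left]
      by (simp add: o_def g_def cinner_scaleC_left divide_inverse mult.commute)
    ultimately show ?thesis by (rule has_integral_unique[rotated])
  qed
  have add: "G (x + x') = G x + G x'" for x x'
  proof (rule has_integral_unique[OF G])
    show "(g (x + x') has_integral G x + G x') {0..1}"
      using has_integral_add[OF G[of x] G[of x']]
      by (simp add: g_def cblinfun_apply_add scaleC_add_right)
  qed
  have scale: "G (c *\<^sub>C x) = c *\<^sub>C G x" for c x
  proof (rule has_integral_unique[OF G])
    show "(g (c *\<^sub>C x) has_integral c *\<^sub>C G x) {0..1}"
      using has_integral_linear[OF G[of x] bounded_linear_scaleC[of c]]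
      by (simp add: g_def cblinfun_apply_scaleC scaleC_scaleC o_def mult.commute)
  qed
  obtain B where B: "0 \<le> B" "\<And>n x y. cmod ((deriv ^^ n) (\<lambda>z. cinner (cblinfun_apply (u z) x) y) 0 / fact n)
    \<le> B / (1 / 2) ^ n * norm x * norm y"
    using Cauchy_inequality_cinner[OF assms, of "1 / 2"] by auto
  define K where "K = B / (1 / 2) ^ n"
  have "norm (G x) \<le> K * norm x" for x
  proof (rule norm_le_cinnerI[of _ 1])
    show "0 \<le> K * norm x" using B(1) by (simp add: K_def)
    show "cmod (cinner (G x) y) \<le> K * norm x * 1" if "norm y = 1" for y
      using B(2)[of n x y] that unfolding Ga a_def K_def by simp
  qed simp
  then have "bounded_linear G"
    by (intro bounded_linear_intro[of G K])
      (simp_all add: add scale scaleR_scaleC[of _ "_::'a"] scaleR_scaleC[of _ "_::'h"] mult.commute)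
  then have "bounded_clinear G" by (simp add: bounded_clinear_def scale)
  then have "cblinfun_apply (CBlinfun G) = G" by (simp add: CBlinfun_inverse)
  then show ?thesis using Ga unfolding a_def by metis
qed

text \<open>The operators are built weakly, so that no completeness of the space of operators is needed;
  norm convergence then follows from Cauchy's inequality, uniformly in the vectors \<open>x\<close> and \<open>y\<close>.\<close>

lemma cholomorphic_power_series_exists:
  fixes u :: "complex \<Rightarrow> ('a::complex_normed_vector, 'h::chilbert_space) cblinfun"
  assumes "u cholomorphic_on ball 0 1"
  shows "\<exists>U. \<forall>z\<in>ball 0 1. (\<lambda>n. z ^ n *\<^sub>C U n) sums u z"
proof -
  obtain U where U: "\<And>n x y. cinner (cblinfun_apply (U n) x) y
      = (deriv ^^ n) (\<lambda>z. cinner (cblinfun_apply (u z) x) y) 0 / fact n"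
    using cblinfun_of_Cauchy_coefficients[OF assms] by metis
  have "(\<lambda>n. z ^ n *\<^sub>C U n) sums u z" if z: "z \<in> ball 0 1" for z
  proof -
    \<comment> \<open>A radius strictly beyond \<open>z\<close> makes the coefficient bound on that
      circle a geometric series of ratio \<open>q\<close> below 1 at \<open>z\<close>.\<close>
    obtain \<rho> where \<rho>: "cmod z < \<rho>" "\<rho> < 1" using z dense by auto
    then have "0 < \<rho>" by (meson norm_ge_zero le_less_trans)
    then obtain B where B: "0 \<le> B" "\<And>n x y. cmod (cinner (cblinfun_apply (U n) x) y) \<le> B / \<rho> ^ n * norm x * norm y"
      using Cauchy_inequality_cinner[OF assms _ \<rho>(2)] unfolding U by metis
    define q where "q = cmod z / \<rho>"
    have q: "0 \<le> q" "q < 1" using \<rho> \<open>0 < \<rho>\<close> by (auto simp: q_def)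
    \<comment> \<open>The scalar tails are bounded by one constant times
      \<open>norm x * norm y\<close>, so the same constant bounds the remainder in operator
      norm.\<close>
    have bound: "norm ((\<Sum>n<N. z ^ n *\<^sub>C U n) - u z) \<le> B / (1 - q) * q ^ N" for N
      unfolding norm_minus_commute[of _ "u z"]
    proof (rule norm_cblinfun_le_cinnerI)
      show "0 \<le> B / (1 - q) * q ^ N" using B q by simp
      fix x :: 'a and y :: 'h
      let ?L = "\<lambda>T. cinner (cblinfun_apply T x) y"
      interpret L: bounded_linear ?L by (rule bounded_linear_cinner_cblinfun)
      have "(\<lambda>n. z ^ n * ?L (U n)) sums ?L (u z)"
        using holomorphic_power_series[OF holomorphic_on_cinner_cblinfun[OF assms] z, of x y]
        by (simp add: U mult.commute)
      from sums_split_initial_segment[OF this, of N]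
      have *: "(\<lambda>n. z ^ (n + N) * ?L (U (n + N))) sums ?L (u z - (\<Sum>n<N. z ^ n *\<^sub>C U n))"
        by (simp add: L.diff L.sum cinner_cblinfun_scaleC)
      have le: "norm (z ^ (n + N) * ?L (U (n + N))) \<le> (B * q ^ N * norm x * norm y) * q ^ n" for n
      proof -
        have "norm (z ^ (n + N) * ?L (U (n + N))) \<le> cmod z ^ (n + N) * (B / \<rho> ^ (n + N) * norm x * norm y)"
          unfolding norm_mult norm_power by (intro mult_left_mono B) simp
        also have "\<dots> = (B * q ^ N * norm x * norm y) * q ^ n"
          by (simp add: q_def power_divide power_add mult_ac)
        finally show ?thesis .
      qed
      have "(\<lambda>n. (B * q ^ N * norm x * norm y) * q ^ n) sums ((B * q ^ N * norm x * norm y) * (1 / (1 - q)))"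
        using q by (intro sums_mult geometric_sums) simp
      then have "norm (\<Sum>n. z ^ (n + N) * ?L (U (n + N))) \<le> (B * q ^ N * norm x * norm y) * (1 / (1 - q))"
        using le by (metis (no_types, lifting) norm_suminf_le sums_iff)
      then show "norm (?L (u z - (\<Sum>n<N. z ^ n *\<^sub>C U n))) \<le> B / (1 - q) * q ^ N * norm x * norm y"
        using sums_unique[OF *] by simp
    qed
    have "(\<lambda>N. B / (1 - q) * q ^ N) \<longlonglongrightarrow> 0"
      using q by (intro tendsto_mult_right_zero LIMSEQ_realpow_zero)
    then have "(\<lambda>N. (\<Sum>n<N. z ^ n *\<^sub>C U n) - u z) \<longlonglongrightarrow> 0"
      by (rule Lim_null_comparison[rotated]) (use bound in simp)
    then show ?thesis by (simp add: sums_def LIM_zero_iff)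
  qed
  then show ?thesis by blast
qed

lemma cinner_power_series_coefficient:
  fixes u :: "complex \<Rightarrow> ('a::complex_normed_vector, 'h::complex_inner) cblinfun"
  assumes "\<forall>z\<in>ball 0 1. (\<lambda>n. z ^ n *\<^sub>C U n) sums u z"
  shows "(deriv ^^ n) (\<lambda>z. cinner (cblinfun_apply (u z) x) y) 0 / fact n = cinner (cblinfun_apply (U n) x) y"
proof (rule higher_deriv_power_series[where R = 1])
  fix z :: complex assume "z \<in> ball 0 1"
  with assms have "(\<lambda>n. z ^ n *\<^sub>C U n) sums u z" by blast
  from bounded_linear.sums[OF bounded_linear_cinner_cblinfun this]
  show "(\<lambda>n. cinner (cblinfun_apply (U n) x) y * z ^ n) sums cinner (cblinfun_apply (u z) x) y"
    by (simp add: cinner_cblinfun_scaleC mult.commute)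
qed simp

text \<open>The definite description is justified: existence is the preceding expansion, and
  uniqueness holds because each coefficient is determined by the Taylor coefficients of the scalar
  functions.\<close>

lemma disc_coeffs_sums:
  fixes u :: "complex \<Rightarrow> ('a::complex_normed_vector, 'h::chilbert_space) cblinfun"
  assumes "u cholomorphic_on ball 0 1"
  shows "\<forall>z\<in>ball 0 1. (\<lambda>n. z ^ n *\<^sub>C disc_coeffs u n) sums u z"
proof -
  have "U = V" if UV: "\<forall>z\<in>ball 0 1. (\<lambda>n. z ^ n *\<^sub>C U n) sums u z" "\<forall>z\<in>ball 0 1. (\<lambda>n. z ^ n *\<^sub>C V n) sums u z"
    for U V
  proof
    fix n
    have "cblinfun_apply (U n) x = cblinfun_apply (V n) x" for x
      by (rule cinner_eqI)
        (simp only: cinner_power_series_coefficient[OF UV(1), symmetric]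
          cinner_power_series_coefficient[OF UV(2), symmetric])
    then show "U n = V n" by (metis cblinfun_apply_inverse ext)
  qed
  then have "\<exists>!U. \<forall>z\<in>ball 0 1. (\<lambda>n. z ^ n *\<^sub>C U n) sums u z"
    using cholomorphic_power_series_exists[OF assms] by blast
  from theI'[OF this] show ?thesis unfolding disc_coeffs_def .
qed

lemmas cinner_disc_coeffs = cinner_power_series_coefficient[OF disc_coeffs_sums]

section \<open>Coefficient estimate\<close>

text \<open>Letting the vector rotate with the circle moves the \<open>n\<close>-th coefficient of the off-diagonal
  function \<open>\<langle>u(z) x, y\<rangle>\<close> into the mean of the quadratic form.\<close>

lemma has_integral_cinner_rotating_vector:
  fixes u :: "complex \<Rightarrow> ('h::complex_inner, 'h) cblinfun" and x y :: 'h
  assumes "u cholomorphic_on ball 0 1" and "0 < \<rho>" and "\<rho> < 1" and "0 < n" and "cmod \<kappa> = 1"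
  defines "v \<equiv> \<lambda>t. x + (\<kappa> * (circlepath 0 \<rho> t / \<rho>) ^ n) *\<^sub>C y"
  shows "((\<lambda>t. cinner (cblinfun_apply (u (circlepath 0 \<rho> t)) (v t)) (v t)) has_integral
    cinner (cblinfun_apply (u 0) x) x + cinner (cblinfun_apply (u 0) y) y
      + cnj \<kappa> * \<rho> ^ n * ((deriv ^^ n) (\<lambda>z. cinner (cblinfun_apply (u z) x) y) 0 / fact n)) {0..1}"
proof -
  define F where "F = (\<lambda>x y z. cinner (cblinfun_apply (u z) x) y)"
  let ?e = "circlepath 0 \<rho>"
  have hol: "F x y holomorphic_on ball 0 1" for x y
    unfolding F_def by (rule holomorphic_on_cinner_cblinfun[OF assms(1)])
  have C: "((\<lambda>t. G (?e t) / ?e t ^ k) has_integral (deriv ^^ k) G 0 / fact k) {0..1}"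
    if "G holomorphic_on ball 0 1" for G k
    by (rule has_integral_Cauchy_coefficient[OF that assms(2,3)])
  \<comment> \<open>The coefficient of index 0 is the mean value property; it yields the two
    diagonal terms.\<close>
  have "((\<lambda>t. F x x (?e t)) has_integral F x x 0) {0..1}" for x
    using C[OF hol, of x x 0] by simp
  moreover have "((\<lambda>t. cnj \<kappa> * \<rho> ^ n * (F x y (?e t) / ?e t ^ n)) has_integral
      cnj \<kappa> * \<rho> ^ n * ((deriv ^^ n) (F x y) 0 / fact n)) {0..1}"
    by (rule has_integral_mult_right[OF C[OF hol]])
  \<comment> \<open>The other off-diagonal term has a holomorphic integrand vanishing at 0, as
    \<open>0 < n\<close>, so its mean is 0.\<close>
  moreover have "((\<lambda>t. \<kappa> * (?e t / \<rho>) ^ n * F y x (?e t)) has_integral 0) {0..1}"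
  proof -
    have "(\<lambda>z. \<kappa> * (z / \<rho>) ^ n * F y x z) holomorphic_on ball 0 1"
      using \<open>0 < \<rho>\<close> by (intro holomorphic_intros hol) auto
    from C[OF this, of 0] show ?thesis using \<open>0 < n\<close> by (simp add: power_0_left)
  qed
  ultimately have "((\<lambda>t. F x x (?e t) + F y y (?e t) + cnj \<kappa> * \<rho> ^ n * (F x y (?e t) / ?e t ^ n)
      + \<kappa> * (?e t / \<rho>) ^ n * F y x (?e t)) has_integral
      F x x 0 + F y y 0 + cnj \<kappa> * \<rho> ^ n * ((deriv ^^ n) (F x y) 0 / fact n) + 0) {0..1}"
    by (intro has_integral_add)
  moreover have "cinner (cblinfun_apply (u (?e t)) (v t)) (v t)
      = F x x (?e t) + F y y (?e t) + cnj \<kappa> * \<rho> ^ n * (F x y (?e t) / ?e t ^ n)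
      + \<kappa> * (?e t / \<rho>) ^ n * F y x (?e t)" for t
  proof -
    define w where "w = \<kappa> * (?e t / \<rho>) ^ n"
    have "cmod (?e t / \<rho>) = 1" using \<open>0 < \<rho>\<close> by (simp add: circlepath norm_mult norm_divide)
    then have "?e t / \<rho> * cnj (?e t / \<rho>) = 1"
      by (simp only: complex_norm_square[symmetric]) simp
    \<comment> \<open>On the circle conjugation is inversion, so the conjugated factor from the
      second slot becomes a negative power, which selects the \<open>n\<close>-th
      coefficient.\<close>
    then have cnj_e: "cnj (?e t / \<rho>) = inverse (?e t / \<rho>)"
      by (metis inverse_unique)
    have "cmod w = 1"
      using \<open>cmod (?e t / \<rho>) = 1\<close> \<open>cmod \<kappa> = 1\<close> by (simp only: w_def norm_mult norm_power) simp
    then have ww: "w * cnj w = 1"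
      by (simp only: complex_norm_square[symmetric]) simp
    have "cnj w = cnj \<kappa> * cnj (?e t / \<rho>) ^ n" by (simp add: w_def)
    then have cnj_w: "cnj w = cnj \<kappa> * \<rho> ^ n / ?e t ^ n"
      unfolding cnj_e by (simp add: power_divide)
    have "cinner (cblinfun_apply (u (?e t)) (v t)) (v t)
        = F x x (?e t) + (w * cnj w) * F y y (?e t) + cnj w * F x y (?e t) + w * F y x (?e t)"
      unfolding v_def F_def w_def[symmetric]
      by (simp add: cblinfun_apply_add cblinfun_apply_scaleC cinner_add_left cinner_add_right
          cinner_scaleC_left cinner_scaleC_right algebra_simps)
    then show ?thesis
      unfolding ww unfolding cnj_w by (simp add: w_def)
  qed
  ultimately show ?thesis by (simp add: F_def)
qed

lemma cinner_disc_coeffs_le: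
  fixes u :: "complex \<Rightarrow> ('h::chilbert_space, 'h) cblinfun"
  assumes u: "u cholomorphic_on ball 0 1" and M: "\<And>z. z \<in> ball 0 1 \<Longrightarrow> norm (u z) \<le> M"
    and u0: "u 0 = \<alpha> *\<^sub>C id_cblinfun" and "0 < n"
  shows "cmod \<alpha> * ((norm x)\<^sup>2 + (norm y)\<^sup>2) + cmod (cinner (cblinfun_apply (disc_coeffs u n) x) y)
    \<le> M * ((norm x)\<^sup>2 + (norm y)\<^sup>2)"
proof -
  define a where "a = cinner (cblinfun_apply (disc_coeffs u n) x) y"
  define s where "s = (norm x)\<^sup>2 + (norm y)\<^sup>2"
  \<comment> \<open>A unimodular phase for every complex number, with 1 as the choice for
    \<open>b = 0\<close>.\<close>
  have rot: "\<exists>\<mu>. cmod \<mu> = 1 \<and> \<mu> * complex_of_real (cmod b) = b" for b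
    by (cases "b = 0") (auto intro!: exI[of _ "if b = 0 then 1 else sgn b"] simp: norm_divide sgn_eq)
  have main: "cmod \<alpha> * s + \<rho> ^ n * cmod a \<le> M * s" if "0 < \<rho>" "\<rho> < 1" for \<rho>
  proof -
    obtain \<mu> where \<mu>: "cmod \<mu> = 1" "\<mu> * complex_of_real (cmod \<alpha>) = \<alpha>" using rot by blast
    obtain \<nu> where \<nu>: "cmod \<nu> = 1" "\<nu> * complex_of_real (cmod a) = a" using rot by blast
    \<comment> \<open>With this choice \<open>cnj \<kappa> * a\<close> equals
      \<open>\<mu> * cmod a\<close>, so both terms of the mean carry the phase \<open>\<mu>\<close>
      and their moduli add.\<close>
    define \<kappa> where "\<kappa> = cnj \<mu> * \<nu>"
    have \<kappa>: "cmod \<kappa> = 1" by (simp add: \<kappa>_def norm_mult \<mu> \<nu>)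
    define v where "v = (\<lambda>t. x + (\<kappa> * (circlepath 0 \<rho> t / \<rho>) ^ n) *\<^sub>C y)"
    let ?u = "\<lambda>t. u (circlepath 0 \<rho> t)"
    have "\<alpha> * s + cnj \<kappa> * \<rho> ^ n * a = \<mu> * complex_of_real (cmod \<alpha> * s + \<rho> ^ n * cmod a)"
    proof -
      have "cnj \<nu> * a = cmod a"
        using \<nu> by (metis complex_norm_square mult.assoc mult.commute mult_1 of_real_1 power_one)
      then show ?thesis
        by (subst \<mu>(2)[symmetric]) (simp add: \<kappa>_def algebra_simps)
    qed
    moreover have "((\<lambda>t. cinner (cblinfun_apply (?u t) (v t)) (v t)) has_integral
        \<alpha> * s + cnj \<kappa> * \<rho> ^ n * a) {0..1}"
      using has_integral_cinner_rotating_vector[OF u that \<open>0 < n\<close> \<kappa>, of x y]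
      by (simp add: v_def a_def s_def cinner_disc_coeffs[OF u] u0 scaleC_cblinfun.rep_eq
          id_cblinfun.rep_eq cinner_scaleC_left cinner_self algebra_simps)
    ultimately have int: "((\<lambda>t. cinner (cblinfun_apply (?u t) (v t)) (v t)) has_integral
        \<mu> * complex_of_real (cmod \<alpha> * s + \<rho> ^ n * cmod a)) {0..1}"
      by simp
    \<comment> \<open>The rotating-vector formula for the constant function
      \<open>id_cblinfun\<close> gives the mean squared length of \<open>v\<close>; its derivative
      term vanishes because \<open>0 < n\<close>.\<close>
    have "((\<lambda>t. cinner (v t) (v t)) has_integral complex_of_real s) {0..1}"
      using has_integral_cinner_rotating_vector[OF cholomorphic_on_const[of id_cblinfun] that \<open>0 < n\<close> \<kappa>, of x y]
        \<open>0 < n\<close>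
      by (simp add: v_def s_def id_cblinfun.rep_eq cinner_self)
    from has_integral_linear[OF this bounded_linear_Re]
    have int_v: "((\<lambda>t. (norm (v t))\<^sup>2) has_integral s) {0..1}"
      by (simp add: o_def cinner_self)
    have "norm (cinner (cblinfun_apply (?u t) (v t)) (v t)) \<le> M * (norm (v t))\<^sup>2" for t
    proof -
      have "circlepath 0 \<rho> t \<in> ball 0 1" using that by (simp add: circlepath norm_mult)
      then have "norm (?u t) * norm (v t) * norm (v t) \<le> M * norm (v t) * norm (v t)"
        by (intro mult_right_mono M) auto
      then show ?thesis
        using cmod_cinner_cblinfun_le[of "?u t" "v t" "v t"] by (simp add: power2_eq_square mult.assoc)
    qed
    then have "norm (integral {0..1} (\<lambda>t. cinner (cblinfun_apply (?u t) (v t)) (v t)))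
        \<le> integral {0..1} (\<lambda>t. M * (norm (v t))\<^sup>2)"
      using int has_integral_mult_right[OF int_v, of M]
      by (intro integral_norm_bound_integral) (auto simp: has_integral_integrable_integral)
    then have "norm (\<mu> * complex_of_real (cmod \<alpha> * s + \<rho> ^ n * cmod a)) \<le> M * s"
      by (simp only: integral_unique[OF int] integral_unique[OF has_integral_mult_right[OF int_v]])
    then have "\<bar>cmod \<alpha> * s + \<rho> ^ n * cmod a\<bar> \<le> M * s"
      by (simp only: norm_mult norm_of_real \<mu> mult_1_left)
    then show ?thesis by simp
  qed
  \<comment> \<open>Holomorphy of \<open>u\<close> is given only on the open disc, so the unit
    circle is reached as a limit from inside.\<close>
  have "((\<lambda>\<rho>. cmod \<alpha> * s + \<rho> ^ n * cmod a) \<longlongrightarrow> cmod \<alpha> * s + 1 ^ n * cmod a) (at_left 1)"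
    by (intro tendsto_intros)
  moreover have "eventually (\<lambda>\<rho>. cmod \<alpha> * s + \<rho> ^ n * cmod a \<le> M * s) (at_left 1)"
    using eventually_at_left_field[of _ "1::real"] main by (auto intro!: exI[of _ 0])
  ultimately have "cmod \<alpha> * s + 1 ^ n * cmod a \<le> M * s"
    by (rule tendsto_upperbound) simp
  then show ?thesis by (simp add: a_def s_def)
qed

lemma disc_coeffs_0:
  fixes u :: "complex \<Rightarrow> ('a::complex_normed_vector, 'h::chilbert_space) cblinfun"
  assumes "u cholomorphic_on ball 0 1"
  shows "disc_coeffs u 0 = u 0"
proof -
  have "cblinfun_apply (disc_coeffs u 0) x = cblinfun_apply (u 0) x" for x
    by (rule cinner_eqI) (simp flip: cinner_disc_coeffs[OF assms])
  then show ?thesis by (metis cblinfun_apply_inverse ext)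
qed

lemma norm_disc_coeffs_le:
  fixes u :: "complex \<Rightarrow> ('h::chilbert_space, 'h) cblinfun"
  assumes u: "u cholomorphic_on ball 0 1" and M: "\<And>z. z \<in> ball 0 1 \<Longrightarrow> norm (u z) \<le> M"
    and u0: "u 0 = \<alpha> *\<^sub>C id_cblinfun" and "0 < n"
  shows "norm (disc_coeffs u n) \<le> 2 * (M - norm (u 0))"
proof (rule norm_cblinfun_le_cinnerI)
  show "0 \<le> 2 * (M - norm (u 0))" using M[of 0] by simp
  fix x y :: 'h assume "norm x = norm y"
  then have "cmod (cinner (cblinfun_apply (disc_coeffs u n) x) y) \<le> 2 * (M - cmod \<alpha>) * (norm x)\<^sup>2"
    using cinner_disc_coeffs_le[OF u M u0 \<open>0 < n\<close>, of x y] by (simp add: algebra_simps)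
  \<comment> \<open>Only an inequality is claimed: on the zero space the identity has norm 0. This
    is the direction required.\<close>
  also have "norm (u 0) \<le> cmod \<alpha>"
    unfolding u0 by (rule norm_cblinfun_leI)
      (simp_all add: scaleC_cblinfun.rep_eq id_cblinfun.rep_eq norm_scaleC)
  then have "2 * (M - cmod \<alpha>) * (norm x)\<^sup>2 \<le> 2 * (M - norm (u 0)) * (norm x)\<^sup>2"
    by (intro mult_right_mono) simp_all
  finally show "cmod (cinner (cblinfun_apply (disc_coeffs u n) x) y) \<le> 2 * (M - norm (u 0)) * norm x * norm y"
    using \<open>norm x = norm y\<close> by (simp add: power2_eq_square mult.assoc)
qed

section \<open>Bohr's inequality from the coefficient estimate\<close>

lemma bohr_operator_le:
  fixes u :: "complex \<Rightarrow> ('h::chilbert_space, 'h) cblinfun"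
  assumes u: "u cholomorphic_on ball 0 1" and M: "\<And>z. z \<in> ball 0 1 \<Longrightarrow> norm (u z) \<le> M"
    and u0: "u 0 = \<alpha> *\<^sub>C id_cblinfun" and "0 \<le> r" and "r \<le> 1 / 3"
  shows "bohr_operator r u \<le> M"
proof -
  define A where "A = norm (u 0)"
  have "A \<le> M" using M[of 0] by (simp add: A_def)
  \<comment> \<open>The estimate starts at index 1; splitting off one factor \<open>r\<close> leaves
    a geometric series indexed from 0.\<close>
  have le: "norm (disc_coeffs u (Suc n)) * r ^ Suc n \<le> 2 * (M - A) * r * r ^ n" for n
    using mult_right_mono[OF norm_disc_coeffs_le[OF u M u0, of "Suc n"], of "r ^ Suc n"] \<open>0 \<le> r\<close>
    by (simp add: A_def mult.assoc)
  have geo: "(\<lambda>n. 2 * (M - A) * r * r ^ n) sums (2 * (M - A) * r * (1 / (1 - r)))"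
    using assms(4,5) by (intro sums_mult geometric_sums) simp
  have summ: "summable (\<lambda>n. norm (disc_coeffs u (Suc n)) * r ^ Suc n)"
    using le \<open>0 \<le> r\<close> by (intro summable_comparison_test'[OF sums_summable[OF geo], of 0]) simp
  have "bohr_operator r u = (\<Sum>n. norm (disc_coeffs u (Suc n)) * r ^ Suc n) + A"
    using suminf_split_head[of "\<lambda>n. norm (disc_coeffs u n) * r ^ n"]
      summ[unfolded summable_Suc_iff[of "\<lambda>n. norm (disc_coeffs u n) * r ^ n"]]
    by (simp add: bohr_operator_def disc_coeffs_0[OF u] A_def del: power_Suc)
  also have "\<dots> \<le> 2 * (M - A) * r * (1 / (1 - r)) + A"
    using suminf_le[OF le summ sums_summable[OF geo]] sums_unique[OF geo] by simp
  also have "\<dots> = (M - A) * (2 * r / (1 - r)) + A" by simp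
  \<comment> \<open>The radius 1/3 originates here: 2r / (1 - r) is at most 1 exactly when 3r is at
    most 1, for r below 1.\<close>
  also have "\<dots> \<le> (M - A) * 1 + A"
    using assms(4,5) \<open>A \<le> M\<close> by (intro add_right_mono mult_left_mono) (auto simp: field_simps)
  finally show ?thesis by simp
qed

theorem theorem2p3:
  fixes f :: "complex \<Rightarrow> ('h::chilbert_space, 'h) cblinfun"
    and \<phi> :: "complex \<Rightarrow> complex" and \<alpha> :: complex and r :: real
  assumes "f cholomorphic_on ball 0 1"
    and "continuous_on (cball 0 1) f"
    and "f 0 = \<alpha> *\<^sub>C id_cblinfun"
    and "cmod \<alpha> < 1"
    and "\<phi> holomorphic_on ball 0 1"
    and "\<phi> ` ball 0 1 \<subseteq> ball 0 1"
    and "\<phi> 0 = 0"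
    and "0 \<le> r" and "r \<le> 1 / 3"
  shows "bohr_operator r (f \<circ> \<phi>) \<le> disc_sup_norm f"
proof (rule bohr_operator_le)
  show "(f \<circ> \<phi>) cholomorphic_on ball 0 1"
    using assms by (intro cholomorphic_on_compose)
  show "(f \<circ> \<phi>) 0 = \<alpha> *\<^sub>C id_cblinfun" using assms by simp
  \<comment> \<open>Continuity on the compact closed disc bounds \<open>f\<close>, so
    \<open>disc_sup_norm f\<close> is a genuine supremum. It also bounds the composite, since
    \<open>\<phi>\<close> maps the disc into itself.\<close>
  have "bounded (f ` cball 0 1)"
    using assms(2) by (intro compact_imp_bounded compact_continuous_image) auto
  then have "bdd_above ((\<lambda>z. norm (f z)) ` ball 0 1)"
    unfolding bounded_iff bdd_above_def by fastforce
  then show "norm ((f \<circ> \<phi>) z) \<le> disc_sup_norm f" if "z \<in> ball 0 1" for z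
    using that assms(6) unfolding disc_sup_norm_def o_apply by (intro cSUP_upper) blast
qed fact+

end
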